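(* If $a,b,c,d$ are relatively prime integers (i.e. $\gcd(a,b,c,d)=1$) satisfying $(a+b+c+d)^2=a^2+b^2+c^2+d^2$, then $|a+b+c|=m^2+mn+n^2$ for some integers $m,n$. *)

theory Defs
  imports Main
begin

end

theory Submission
  imports Defs
begin

text \<open>
  Write \<open>s = a + b + c\<close> and \<open>t = a + b + d\<close>. The hypothesis says that the second elementary
  symmetric function of \<open>a, b, c, d\<close> vanishes, and this rearranges to \<open>a\<^sup>2 + a b + b\<^sup>2 = s t\<close>.
  Let \<open>\<zeta>\<close> be a primitive sixth root of unity, so \<open>\<zeta>\<^sup>2 = \<zeta> - 1\<close>; the left-hand side is the norm
  of \<open>\<alpha> = a + b \<zeta>\<close> in the Eisenstein integers. Thus the Hermitian matrix with diagonal \<open>s, t\<close> and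
  off-diagonal entry \<open>\<alpha>\<close> is singular, and it is primitive because a common divisor of
  \<open>s, a, b, t\<close> divides \<open>a, b, c, d\<close>. Since \<open>s t\<close> is a norm, it is nonnegative, so \<open>s\<close> and \<open>t\<close>
  may be replaced by their absolute values, and the matrix becomes positive semidefinite.

  A primitive positive semidefinite singular matrix of this kind is a rank one matrix
  \<open>v v\<^sup>*\<close> with \<open>v = (x, y)\<close> an Eisenstein vector, whence \<open>s = x * cnj x\<close> has the required form.
  This is proved by descent, as in the reduction theory of Hermitian forms: a shear
  \<open>\<alpha> \<mapsto> \<alpha> - s \<beta>\<close> with a suitable unit \<open>\<beta>\<close> makes the larger diagonal entry strictly smaller
  (lemma \<open>exists_unit_large_trace\<close>) and preserves primitivity, and a factorisation \<open>v v\<^sup>*\<close> of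
  the sheared matrix gives one of the original (lemma \<open>eisenstein_rank1_shear\<close>). The descent
  ends when a diagonal entry is zero; then \<open>\<alpha>\<close> is zero too and primitivity forces the other entry to be \<open>1\<close>.
\<close>

definition eisenstein_norm :: "int \<Rightarrow> int \<Rightarrow> int" where
  "eisenstein_norm a b = a\<^sup>2 + a * b + b\<^sup>2"

text \<open>
  The matrix with diagonal \<open>s, t\<close> and upper right entry \<open>a + b \<zeta>\<close> equals \<open>v v\<^sup>*\<close> for
  \<open>v = (x\<^sub>1 + x\<^sub>2 \<zeta>, y\<^sub>1 + y\<^sub>2 \<zeta>)\<close>; the last two equations are the coordinates of
  \<open>(x\<^sub>1 + x\<^sub>2 \<zeta>) (y\<^sub>1 + y\<^sub>2 - y\<^sub>2 \<zeta>)\<close>, where the second factor is the conjugate of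
  \<open>y\<^sub>1 + y\<^sub>2 \<zeta>\<close>.
\<close>
definition eisenstein_rank1 :: "int \<Rightarrow> int \<Rightarrow> int \<Rightarrow> int \<Rightarrow> bool" where
  "eisenstein_rank1 s a b t \<longleftrightarrow> (\<exists>x1 x2 y1 y2.
     s = eisenstein_norm x1 x2 \<and> t = eisenstein_norm y1 y2 \<and>
     a = x1 * y1 + x1 * y2 + x2 * y2 \<and> b = x2 * y1 - x1 * y2)"

lemma four_eisenstein_norm: "4 * eisenstein_norm a b = (2 * a + b)\<^sup>2 + 3 * b\<^sup>2"
  by (simp add: eisenstein_norm_def power2_eq_square algebra_simps)

lemma eisenstein_norm_nonneg: "eisenstein_norm a b \<ge> 0"
  using four_eisenstein_norm[of a b] zero_le_power2[of "2 * a + b"] zero_le_power2[of b]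
  by linarith

lemma eisenstein_norm_eq_0_iff: "eisenstein_norm a b = 0 \<longleftrightarrow> a = 0 \<and> b = 0"
proof
  assume "eisenstein_norm a b = 0"
  then have "(2 * a + b)\<^sup>2 + 3 * b\<^sup>2 = 0"
    using four_eisenstein_norm[of a b] by simp
  then have "(2 * a + b)\<^sup>2 = 0 \<and> b\<^sup>2 = 0"
    using zero_le_power2[of "2 * a + b"] zero_le_power2[of b] by linarith
  then show "a = 0 \<and> b = 0" by simp
qed (simp add: eisenstein_norm_def)

text \<open>Exchanging the two coordinates of \<open>v\<close> conjugates the off-diagonal entry, and
  \<open>cnj (a + b \<zeta>) = (a + b) - b \<zeta>\<close>.\<close>
lemma eisenstein_rank1_swap:
  assumes "eisenstein_rank1 t (a + b) (- b) s"
  shows "eisenstein_rank1 s a b t"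
proof -
  obtain x1 x2 y1 y2 where v: "t = eisenstein_norm x1 x2" "s = eisenstein_norm y1 y2"
    "a + b = x1 * y1 + x1 * y2 + x2 * y2" "- b = x2 * y1 - x1 * y2"
    using assms unfolding eisenstein_rank1_def by blast
  have "a = y1 * x1 + y1 * x2 + y2 * x2" "b = y2 * x1 - y1 * x2"
    using v(3,4) by (simp_all add: algebra_simps)
  with v(1,2) show ?thesis
    unfolding eisenstein_rank1_def by blast
qed

text \<open>
  With \<open>\<beta> = u + w \<zeta>\<close>, replacing \<open>y\<close> by \<open>y + x * cnj \<beta>\<close> in \<open>v = (x, y)\<close> adds \<open>s \<beta>\<close> to
  \<open>x * cnj y\<close>. The lower diagonal entry of the matrix before this change is the norm form
  expanded at \<open>\<alpha> - s \<beta>\<close>: its middle term is the trace of \<open>\<alpha> * cnj \<beta>\<close>.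
\<close>
lemma eisenstein_rank1_shear:
  assumes "eisenstein_rank1 s (a - s * u) (b - s * w)
    (t - (2 * a * u + a * w + b * u + 2 * b * w) + s * eisenstein_norm u w)"
  shows "eisenstein_rank1 s a b t"
proof -
  obtain x1 x2 y1 y2 where v: "s = eisenstein_norm x1 x2"
    "t - (2 * a * u + a * w + b * u + 2 * b * w) + s * eisenstein_norm u w = eisenstein_norm y1 y2"
    "a - s * u = x1 * y1 + x1 * y2 + x2 * y2" "b - s * w = x2 * y1 - x1 * y2"
    using assms unfolding eisenstein_rank1_def by blast
  \<comment> \<open>The coordinates of \<open>y + x * cnj \<beta>\<close>, where \<open>cnj \<beta> = u + w - w \<zeta>\<close>.\<close>
  define z1 where "z1 = y1 + x1 * u + x1 * w + x2 * w"
  define z2 where "z2 = y2 + x2 * u - x1 * w"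
  have a: "a = x1 * y1 + x1 * y2 + x2 * y2 + s * u" and b: "b = x2 * y1 - x1 * y2 + s * w"
    using v(3,4) by linarith+
  have t: "t = eisenstein_norm y1 y2 + (2 * a * u + a * w + b * u + 2 * b * w)
      - s * eisenstein_norm u w"
    using v(2) by linarith
  have "t = eisenstein_norm z1 z2"
    unfolding t a b v(1) z1_def z2_def eisenstein_norm_def
    by (simp add: power2_eq_square algebra_simps)
  moreover have "a = x1 * z1 + x1 * z2 + x2 * z2" "b = x2 * z1 - x1 * z2"
    unfolding a b v(1) z1_def z2_def eisenstein_norm_def
    by (simp_all add: power2_eq_square algebra_simps)
  ultimately show ?thesis
    using v(1) unfolding eisenstein_rank1_def by blast
qed

text \<open>
  The traces of \<open>\<alpha> * cnj \<beta>\<close> for the six units \<open>\<beta>\<close> are \<open>\<plusminus>(2a + b)\<close>, \<open>\<plusminus>(a + 2b)\<close> and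
  \<open>\<plusminus>(a - b)\<close>. The squares of the last three add up to six times the norm of \<open>\<alpha>\<close>, so they
  cannot all be at most \<open>s\<^sup>2\<close>.
\<close>
lemma exists_unit_large_trace:
  assumes "s > 0" and "s\<^sup>2 \<le> eisenstein_norm a b"
  obtains u w where "eisenstein_norm u w = 1" "s < 2 * a * u + a * w + b * u + 2 * b * w"
proof -
  have "s < \<bar>2 * a + b\<bar> \<or> s < \<bar>a + 2 * b\<bar> \<or> s < \<bar>a - b\<bar>"
  proof (rule ccontr)
    assume "\<not> ?thesis"
    then have "(2 * a + b)\<^sup>2 \<le> s\<^sup>2" "(a + 2 * b)\<^sup>2 \<le> s\<^sup>2" "(a - b)\<^sup>2 \<le> s\<^sup>2"
      using \<open>s > 0\<close> by (simp_all add: abs_le_square_iff[symmetric])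
    moreover have "(2 * a + b)\<^sup>2 + (a + 2 * b)\<^sup>2 + (a - b)\<^sup>2 = 6 * eisenstein_norm a b"
      by (simp add: eisenstein_norm_def power2_eq_square algebra_simps)
    moreover have "s\<^sup>2 > 0" using \<open>s > 0\<close> by simp
    ultimately show False using assms(2) by linarith
  qed
  then consider "s < 2 * a + b" | "s < - (2 * a + b)" | "s < a + 2 * b" | "s < - (a + 2 * b)"
    | "s < a - b" | "s < - (a - b)"
    by linarith
  then show ?thesis
  proof cases
    case 1 then show ?thesis using that[of 1 0] by (simp add: eisenstein_norm_def)
  next
    case 2 then show ?thesis using that[of "-1" 0] by (simp add: eisenstein_norm_def)
  next
    case 3 then show ?thesis using that[of 0 1] by (simp add: eisenstein_norm_def)
  next
    case 4 then show ?thesis using that[of 0 "-1"] by (simp add: eisenstein_norm_def)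
  next
    case 5 then show ?thesis using that[of 1 "-1"] by (simp add: eisenstein_norm_def)
  next
    case 6 then show ?thesis using that[of "-1" 1] by (simp add: eisenstein_norm_def)
  qed
qed

text \<open>
  Descent on the trace \<open>s + t\<close>. After a swap the smaller diagonal entry is \<open>s\<close>, so that
  \<open>s\<^sup>2 \<le> s t\<close>, the norm of \<open>\<alpha>\<close>, and a shear by the unit found above lowers \<open>t\<close>. Primitivity
  is essential: a prime that is not a norm, such as \<open>2\<close>, times a nonzero matrix \<open>v v\<^sup>*\<close>
  is singular but not itself of that form.
\<close>
lemma primitive_singular_imp_eisenstein_rank1:
  assumes "s \<ge> 0" "t \<ge> 0" "eisenstein_norm a b = s * t"
    and "\<And>k. k dvd s \<Longrightarrow> k dvd a \<Longrightarrow> k dvd b \<Longrightarrow> k dvd t \<Longrightarrow> is_unit k"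
  shows "eisenstein_rank1 s a b t"
proof -
  define n where "n = nat (s + t)"
  from n_def assms show ?thesis
  proof (induction n arbitrary: s t a b rule: less_induct)
    case (less n)
    have ordered: "eisenstein_rank1 s a b t"
      if st: "0 \<le> s" "s \<le> t" and n: "n = nat (s + t)" and norm: "eisenstein_norm a b = s * t"
        and prim: "\<And>k. k dvd s \<Longrightarrow> k dvd a \<Longrightarrow> k dvd b \<Longrightarrow> k dvd t \<Longrightarrow> is_unit k"
      for s t a b
    proof (cases "s = 0")
      case True
      then have ab: "a = 0" "b = 0"
        using norm by (simp_all add: eisenstein_norm_eq_0_iff)
      have "is_unit t"
        using prim[of t] True ab by simp
      then have "t = 1"
        using st by simp
      \<comment> \<open>The matrix with diagonal \<open>0, 1\<close> comes from \<open>v = (0, 1)\<close>.\<close>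
      then show ?thesis
        unfolding eisenstein_rank1_def eisenstein_norm_def
        by (intro exI[of _ 0] exI[of _ 1]) (simp add: True ab)
    next
      case False
      then have "s > 0" using st by simp
      have "s\<^sup>2 \<le> eisenstein_norm a b"
        unfolding norm power2_eq_square using st by (intro mult_left_mono)
      then obtain u w where unit: "eisenstein_norm u w = 1"
        and trace: "s < 2 * a * u + a * w + b * u + 2 * b * w"
        using exists_unit_large_trace[OF \<open>s > 0\<close>] by blast
      define a' where "a' = a - s * u"
      define b' where "b' = b - s * w"
      define t' where
        "t' = t - (2 * a * u + a * w + b * u + 2 * b * w) + s * eisenstein_norm u w"
      have "eisenstein_norm a' b' = eisenstein_norm a b
          - s * (2 * a * u + a * w + b * u + 2 * b * w) + s * (s * eisenstein_norm u w)"
        unfolding a'_def b'_def eisenstein_norm_def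
        by (simp add: power2_eq_square algebra_simps)
      then have norm': "eisenstein_norm a' b' = s * t'"
        unfolding norm t'_def by (simp add: algebra_simps)
      have "t' < t" using trace unit unfolding t'_def by simp
      moreover have "t' \<ge> 0"
        using eisenstein_norm_nonneg[of a' b'] norm' \<open>s > 0\<close> by (simp add: zero_le_mult_iff)
      moreover have "is_unit k" if k: "k dvd s" "k dvd a'" "k dvd b'" "k dvd t'" for k
      proof -
        have "k dvd a' + s * u" "k dvd b' + s * w"
          using k by simp_all
        then have ab: "k dvd a" "k dvd b"
          unfolding a'_def b'_def by simp_all
        have "k dvd t' + (2 * a * u + a * w + b * u + 2 * b * w) - s * eisenstein_norm u w"
          using k ab by (intro dvd_add dvd_diff dvd_mult2 dvd_mult)
        then have "k dvd t"
          unfolding t'_def by simp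
        with prim k(1) ab show ?thesis by blast
      qed
      ultimately have "eisenstein_rank1 s a' b' t'"
        using less.IH[of "nat (s + t')" s t' a' b'] norm' n \<open>s > 0\<close> by simp
      then show ?thesis
        unfolding a'_def b'_def t'_def by (rule eisenstein_rank1_shear)
    qed
    show ?case
    proof (cases "s \<le> t")
      case True
      then show ?thesis using ordered less.prems by blast
    next
      case False
      have "eisenstein_norm (a + b) (- b) = t * s"
        using less.prems(4)
        by (simp add: eisenstein_norm_def power2_eq_square algebra_simps)
      moreover have "is_unit k" if "k dvd t" "k dvd a + b" "k dvd - b" "k dvd s" for k
        using that less.prems(5)[of k] by (simp add: dvd_add_left_iff)
      ultimately have "eisenstein_rank1 t (a + b) (- b) s"
        using ordered[of t s "a + b" "- b"] False less.prems by (simp add: add.commute)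
      then show ?thesis by (rule eisenstein_rank1_swap)
    qed
  qed
qed

theorem corollary4p6:
  fixes a b c d :: int
  assumes "Gcd {a, b, c, d} = 1"
    and "(a + b + c + d)^2 = a^2 + b^2 + c^2 + d^2"
  shows "\<exists>m n :: int. \<bar>a + b + c\<bar> = m^2 + m * n + n^2"
proof -
  have norm: "eisenstein_norm a b = (a + b + c) * (a + b + d)"
    using assms(2) by (simp add: eisenstein_norm_def power2_eq_square algebra_simps)
  have abs_norm: "eisenstein_norm a b = \<bar>a + b + c\<bar> * \<bar>a + b + d\<bar>"
    using norm eisenstein_norm_nonneg[of a b] by (simp add: abs_mult[symmetric])
  have "is_unit k" if k: "k dvd \<bar>a + b + c\<bar>" "k dvd a" "k dvd b" "k dvd \<bar>a + b + d\<bar>" for k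
  proof -
    have "k dvd c" "k dvd d"
      using k by (simp_all add: dvd_add_right_iff)
    then have "k dvd Gcd {a, b, c, d}"
      using k by simp
    then show ?thesis unfolding assms(1) .
  qed
  then have "eisenstein_rank1 \<bar>a + b + c\<bar> a b \<bar>a + b + d\<bar>"
    by (intro primitive_singular_imp_eisenstein_rank1) (simp_all add: abs_norm)
  then show ?thesis
    unfolding eisenstein_rank1_def eisenstein_norm_def by blast
qed

end
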